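(* Let $p_n^{\text{pos}}(\text{id},\cdot)$ be the distribution on $S_n$ of the position cyclic to random transposition shuffle started from the identity permutation. (i) Let $(b_n)_{n\ge 1}$ and $(x_n)_{n\ge1}$ be sequences such that $b_nn$ and $x_nn$ are integers in $[n]$ for every $n$, and assume that $\lim_{n\to\infty}b_n=b\in[0,1]$ and $\lim_{n\to\infty}x_n=x\in[0,1]$. Then, for the position $\sigma^{-1}_{b_nn}$ of card number $b_nn$, $$ f^{\text{pos}}_b(x)\equiv\lim_{n\to\infty}n\,p_n^{\text{pos}}(\text{id},\{\sigma^{-1}_{b_nn}=x_nn\})= \begin{cases} e^{-1+x}+e^{-b},& x<b;\\ e^{-1+x}+e^{-b}-e^{-1-b+x},& x>b. \end{cases} $$ (ii) Let $(x_n)_{n\ge1}$ and $(b_n)_{n\ge 1}$ be sequences such that $x_nn$ and $b_nn$ are integers in $[n]$ for every $n$, and assume that $\lim_{n\to\infty}x_n=x\in[0,1]$ and $\lim_{n\to\infty}b_n=b\in[0,1]$. Then, for the number $\sigma_{x_nn}$ of the card in position $x_nn$, $$ h^{\text{pos}}_x(b)\equiv\lim_{n\to\infty}n\,p_n^{\text{pos}}(\text{id},\{\sigma_{x_nn}=b_nn\})= \begin{cases} e^{-1+x}+e^{-b}-e^{-1-b+x},& b<x;\\ e^{-1+x}+e^{-b},& b>x. \end{cases} $$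
   Context: $S_n$ is the symmetric group of permutations of $[n]=\{1,\dots,n\}$. A permutation $\sigma\in S_n$ is viewed as a deck of cards numbered $1$ to $n$ laid out in a row, where $\sigma_j$ denotes the number of the card in the $j$-th position from the left; $\sigma^{-1}_j$ denotes the position occupied by card number $j$. The position cyclic to random transposition shuffle, started from a given $\sigma\in S_n$, consists of $n$ steps performed in order $j=1,\dots,n$: on the $j$-th step, transpose (exchange the positions of) the card that is currently in the $j$-th position from the left with a card chosen uniformly at random from all $n$ cards (possibly itself), the choices at different steps being independent. The distribution on $S_n$ of the arrangement after the $n$ steps is denoted $p_n^{\text{pos}}(\sigma,\cdot)$; $\text{id}$ is the identity permutation. *)

theory Defs
  imports "HOL-Probability.Probability" "HOL-Combinatorics.Permutations"
begin

text \<open>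
  A deck is a function \<open>\<sigma>\<close> with \<open>\<sigma> permutes {1..n}\<close>, sending a position (from the left) to the
  number of the card there, so \<open>inv \<sigma> i\<close> is the position of card \<open>i\<close>. Exchanging the positions
  of the cards \<open>\<sigma> j\<close> and \<open>c\<close> therefore means composing with the transposition of these two card
  numbers on the left.
\<close>

definition pos_step :: "nat \<Rightarrow> nat \<Rightarrow> (nat \<Rightarrow> nat) \<Rightarrow> (nat \<Rightarrow> nat) pmf" where
  "pos_step n j \<sigma> = map_pmf (\<lambda>c. Transposition.transpose (\<sigma> j) c \<circ> \<sigma>) (pmf_of_set {1..n})"

definition pos_shuffle :: "nat \<Rightarrow> (nat \<Rightarrow> nat) \<Rightarrow> (nat \<Rightarrow> nat) pmf" where
  "pos_shuffle n \<sigma> = fold (\<lambda>j p. p \<bind> pos_step n j) [1..<Suc n] (return_pmf \<sigma>)"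

lemma set_pmf_pos_step:
  assumes "\<sigma> permutes {1..n}" "j \<in> {1..n}"
  shows "set_pmf (pos_step n j \<sigma>) \<subseteq> {\<tau>. \<tau> permutes {1..n}}"
proof -
  have "set_pmf (pmf_of_set {1..n}) = {1..n}"
    using assms(2) by (intro set_pmf_of_set) auto
  moreover have "\<sigma> j \<in> {1..n}"
    using assms permutes_in_image by metis
  ultimately show ?thesis
    using assms(1) by (auto simp: pos_step_def intro!: permutes_compose permutes_swap_id)
qed

lemma set_pmf_pos_shuffle:
  assumes "\<sigma> permutes {1..n}"
  shows "set_pmf (pos_shuffle n \<sigma>) \<subseteq> {\<tau>. \<tau> permutes {1..n}}"
proof -
  have "set_pmf (fold (\<lambda>j p. p \<bind> pos_step n j) js q) \<subseteq> {\<tau>. \<tau> permutes {1..n}}"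
    if "set js \<subseteq> {1..n}" "set_pmf q \<subseteq> {\<tau>. \<tau> permutes {1..n}}" for js q
    using that
  proof (induction js arbitrary: q)
    case (Cons j js)
    have "set_pmf (q \<bind> pos_step n j) \<subseteq> {\<tau>. \<tau> permutes {1..n}}"
      using Cons.prems set_pmf_pos_step[of _ n j] by (fastforce simp: set_bind_pmf)
    then show ?case
      using Cons by simp
  qed simp
  moreover have "set [1..<Suc n] \<subseteq> {1..n}"
    by auto
  ultimately show ?thesis
    using assms by (simp add: pos_shuffle_def del: upt_Suc)
qed

end

theory Submission imports Defs "HOL-Real_Asymp.Real_Asymp" begin

text \<open>
  Fix a card \<open>i\<close> and write \<open>q\<^sub>j(k)\<close> for the probability that it lies in position \<open>k\<close> after
  \<open>j\<close> steps. The position of a single card is itself a Markov chain. If the card is the one in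
  position \<open>j\<close> when step \<open>j\<close> is made, it lands in a uniformly chosen position; otherwise it is
  drawn, and so moves to position \<open>j\<close>, with probability \<open>1/n\<close>. Hence, with \<open>u = 1 - 1/n\<close>,
  \<open>q\<^sub>j(j) = 1/n\<close>, and \<open>q\<^sub>j(k) = u q\<^sub>j\<^sub>-\<^sub>1(k) + q\<^sub>j\<^sub>-\<^sub>1(j)/n\<close> for \<open>k \<noteq> j\<close>
  (\<open>prob_card_at_step\<close>).

  This recursion can be solved exactly. Card \<open>i\<close> is still in its place when step \<open>i\<close> is made
  with probability \<open>u\<^sup>i\<^sup>-\<^sup>1\<close>, namely if it has not been drawn before; otherwise it is in a position
  already treated. Step \<open>i\<close> therefore throws mass \<open>u\<^sup>i\<^sup>-\<^sup>1/n\<close> into every other position. From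
  then on all positions not yet treated hold the same mass, and this mass is conserved: in each
  step such a position loses the fraction \<open>1/n\<close> of what it holds and gains the fraction \<open>1/n\<close> of
  what the position being treated holds, which is the same amount. So every treated position is
  fed at a constant rate from then on, and after all \<open>n\<close> steps
  \<open>n q\<^sub>n(k) = u\<^sup>n\<^sup>-\<^sup>k + u\<^sup>i\<^sup>-\<^sup>1 - [i \<le> k] u\<^sup>n\<^sup>-\<^sup>k u\<^sup>i\<^sup>-\<^sup>1\<close> (\<open>prob_card_at_pos_shuffle\<close>).
  The limits follow from \<open>(1 - 1/n)\<^sup>m \<rightarrow> exp (-t)\<close> when \<open>m/n \<rightarrow> t\<close>. Both parts of the theorem
  speak of the same event, that card \<open>i\<close> is in position \<open>k\<close>.
\<close>

definition pos_steps :: "nat \<Rightarrow> nat \<Rightarrow> (nat \<Rightarrow> nat) pmf" where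
  "pos_steps n j = fold (\<lambda>j p. p \<bind> pos_step n j) [1..<Suc j] (return_pmf id)"

lemma pos_steps_0: "pos_steps n 0 = return_pmf id"
  by (simp add: pos_steps_def)

lemma pos_steps_Suc: "pos_steps n (Suc j) = pos_steps n j \<bind> pos_step n (Suc j)"
  by (simp add: pos_steps_def)

lemma pos_shuffle_eq_pos_steps: "pos_shuffle n id = pos_steps n n"
  by (simp add: pos_shuffle_def pos_steps_def)

lemma set_pmf_pos_steps:
  "j \<le> n \<Longrightarrow> \<sigma> \<in> set_pmf (pos_steps n j) \<Longrightarrow> \<sigma> permutes {1..n}"
proof (induction j arbitrary: \<sigma>)
  case 0
  then show ?case by (metis pos_steps_0 set_return_pmf singletonD permutes_id)
next
  case (Suc j)
  then obtain \<tau> where \<tau>: "\<tau> \<in> set_pmf (pos_steps n j)" "\<sigma> \<in> set_pmf (pos_step n (Suc j) \<tau>)"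
    by (auto simp: pos_steps_Suc)
  then show ?case
    using Suc set_pmf_pos_step[of \<tau> n "Suc j"] by auto
qed

definition card_at :: "nat \<Rightarrow> nat \<Rightarrow> (nat \<Rightarrow> nat) set" where
  "card_at i k = {\<sigma>. \<sigma> k = i}"

text \<open>
  The transposition acts on card numbers. For \<open>k = j\<close> the drawn card itself ends up in position
  \<open>j\<close>. For \<open>k \<noteq> j\<close>, card \<open>i\<close> is in position \<open>k\<close> afterwards iff it was there before and was not
  drawn, or it was in position \<open>j\<close> and the card of position \<open>k\<close> was drawn.
\<close>
lemma prob_pos_step_card_at:
  assumes perm: "\<sigma> permutes {1..n}" and j: "j \<in> {1..n}" and i: "i \<in> {1..n}"
    and k: "k \<in> {1..n}"
  shows "measure_pmf.prob (pos_step n j \<sigma>) (card_at i k) =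
    (if k = j then 1 / n else (1 - 1 / n) * indicator (card_at i k) \<sigma> + indicator (card_at i j) \<sigma> / n)"
proof -
  define C where "C = {c \<in> {1..n}. Transposition.transpose (\<sigma> j) c (\<sigma> k) = i}"
  have "measure_pmf.prob (pos_step n j \<sigma>) (card_at i k) = card C / n"
  proof -
    have "{1..n} \<inter> (\<lambda>c. Transposition.transpose (\<sigma> j) c \<circ> \<sigma>) -` card_at i k = C"
      by (auto simp: C_def card_at_def)
    moreover have "finite {1..n}" "{1..n} \<noteq> {}" using j by auto
    ultimately show ?thesis
      by (simp add: pos_step_def measure_pmf_of_set)
  qed
  moreover have "C = {i}" if "k = j"
    using i that by (auto simp: C_def)
  moreover have "card C / n = (1 - 1 / n) * indicator (card_at i k) \<sigma> + indicator (card_at i j) \<sigma> / n"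
    if "k \<noteq> j"
  proof -
    have ne: "\<sigma> k \<noteq> \<sigma> j"
      using permutes_inj[OF perm] that by (auto dest: injD)
    consider "\<sigma> k = i" | "\<sigma> j = i" | "\<sigma> k \<noteq> i" "\<sigma> j \<noteq> i" by blast
    then show ?thesis
    proof cases
      case 1
      then have "C = {1..n} - {i}"
        using ne by (auto simp: C_def Transposition.transpose_def split: if_splits)
      then have "card C = n - 1" using i by simp
      then show ?thesis
        using 1 ne i by (auto simp: card_at_def of_nat_diff field_simps)
    next
      case 2
      have "\<sigma> k \<in> {1..n}"
        using permutes_in_image[OF perm] k by blast
      then have "C = {\<sigma> k}"
        using ne 2 unfolding C_def by (auto simp: transpose_eq_iff)
      then show ?thesis
        using 2 ne by (auto simp: card_at_def)
    next
      case 3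
      then have "C = {}"
        using ne unfolding C_def Transposition.transpose_def by auto
      then show ?thesis
        using 3 by (auto simp: card_at_def)
    qed
  qed
  ultimately show ?thesis by simp
qed

lemma prob_card_at_step:
  assumes j: "Suc j \<le> n" and i: "i \<in> {1..n}" and k: "k \<in> {1..n}"
  shows "measure_pmf.prob (pos_steps n (Suc j)) (card_at i k) =
    (if k = Suc j then 1 / n
     else (1 - 1 / n) * measure_pmf.prob (pos_steps n j) (card_at i k)
          + measure_pmf.prob (pos_steps n j) (card_at i (Suc j)) / n)"
proof -
  let ?q = "pos_steps n j"
  have "measure_pmf.prob (pos_steps n (Suc j)) (card_at i k) =
      (\<integral>\<sigma>. measure_pmf.prob (pos_step n (Suc j) \<sigma>) (card_at i k) \<partial>measure_pmf ?q)"
    using pmf_bind[of ?q "\<lambda>\<sigma>. map_pmf (\<lambda>\<tau>. \<tau> k) (pos_step n (Suc j) \<sigma>)" i]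
    by (simp add: pos_steps_Suc pmf_map card_at_def vimage_def flip: map_bind_pmf)
  also have "\<dots> = (\<integral>\<sigma>. (if k = Suc j then 1 / n
      else (1 - 1 / n) * indicator (card_at i k) \<sigma> + indicator (card_at i (Suc j)) \<sigma> / n)
      \<partial>measure_pmf ?q)"
    using assms set_pmf_pos_steps[of j n]
    by (intro integral_cong_AE) (auto simp: AE_measure_pmf_iff prob_pos_step_card_at)
  also have "\<dots> = (if k = Suc j then 1 / n
     else (1 - 1 / n) * measure_pmf.prob ?q (card_at i k)
          + measure_pmf.prob ?q (card_at i (Suc j)) / n)"
  proof -
    have "integrable (measure_pmf ?q) (indicator A :: _ \<Rightarrow> real)" for A
      by (intro measure_pmf.integrable_const_bound[where B = 1]) (auto simp: indicator_def)
    then show ?thesis by simp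
  qed
  finally show ?thesis .
qed

text \<open>
  The exact solution of the recursion, with \<open>j\<close> the number of steps made. A position \<open>k > j\<close>
  still to be treated holds card \<open>i\<close> either because it is the initial place of the card, which has
  not been drawn, or because the card has been thrown there. A treated position \<open>k \<le> j\<close> restarted from
  \<open>1/n\<close> at step \<open>k\<close>, of which the fraction \<open>u\<^sup>j\<^sup>-\<^sup>k\<close> is left, and received mass afterwards. If
  \<open>k < i \<le> j\<close>, it received \<open>u\<^sup>i\<^sup>-\<^sup>1/n\<close> at step \<open>i\<close>, an amount that the later steps preserve; if
  \<open>i \<le> k\<close>, it received only \<open>u\<^sup>i\<^sup>-\<^sup>1/n\<^sup>2\<close> in each step after \<open>k\<close>, and the geometric sum
  of these makes up \<open>u\<^sup>i\<^sup>-\<^sup>1 (1 - u\<^sup>j\<^sup>-\<^sup>k)/n\<close>.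
\<close>
lemma prob_card_at_pos_steps:
  fixes n :: nat
  defines "u \<equiv> 1 - 1 / real n"
  assumes i: "i \<in> {1..n}"
  shows "j \<le> n \<Longrightarrow> k \<in> {1..n} \<Longrightarrow> measure_pmf.prob (pos_steps n j) (card_at i k) =
    (if k \<le> j
     then (u ^ (j - k) + of_bool (i \<le> j) * u ^ (i - 1)
             - of_bool (i \<le> k) * (u ^ (j - k) * u ^ (i - 1))) / n
     else of_bool (i = k) * u ^ j + of_bool (i \<le> j) * u ^ (i - 1) / n)"
proof (induction j arbitrary: k)
  case 0
  then show ?case
    using i by (auto simp: pos_steps_0 card_at_def measure_return_pmf)
next
  case (Suc j)
  \<comment> \<open>Trading \<open>1/n\<close> for \<open>1 - u\<close> turns the induction step into a polynomial identity in \<open>u\<close>.\<close>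
  have div_n: "\<And>r. r / real n = r * (1 - u)"
    by (simp add: u_def)
  have IH: "measure_pmf.prob (pos_steps n j) (card_at i k) =
    (if k \<le> j
     then (u ^ (j - k) + of_bool (i \<le> j) * u ^ (i - 1)
             - of_bool (i \<le> k) * (u ^ (j - k) * u ^ (i - 1))) / n
     else of_bool (i = k) * u ^ j + of_bool (i \<le> j) * u ^ (i - 1) / n)" if "k \<in> {1..n}" for k
    using Suc that by simp
  have step: "measure_pmf.prob (pos_steps n (Suc j)) (card_at i k) =
    (if k = Suc j then 1 / n
     else u * measure_pmf.prob (pos_steps n j) (card_at i k)
          + measure_pmf.prob (pos_steps n j) (card_at i (Suc j)) / n)"
    unfolding u_def using Suc.prems i by (intro prob_card_at_step) auto
  have at_step: "measure_pmf.prob (pos_steps n j) (card_at i (Suc j)) =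
      of_bool (i = Suc j) * u ^ j + of_bool (i \<le> j) * u ^ (i - 1) / n"
    using IH[of "Suc j"] Suc.prems by simp
  consider "k = Suc j" | "k \<le> j" | "k > Suc j" by linarith
  then show ?case
  proof cases
    case 1
    then show ?thesis using step by auto
  next
    case 2
    then have "Suc j - k = Suc (j - k)" by simp
    then show ?thesis
      using 2 Suc.prems i
      by (auto simp: step at_step IH div_n le_Suc_eq algebra_simps)
  next
    case 3
    then show ?thesis
      using Suc.prems i by (auto simp: step at_step IH div_n le_Suc_eq algebra_simps)
  qed
qed

lemma prob_card_at_pos_shuffle:
  assumes i: "i \<in> {1..n}" and k: "k \<in> {1..n}"
  shows "n * measure_pmf.prob (pos_shuffle n id) {\<sigma>. \<sigma> k = i} =
    (1 - 1 / n) ^ (n - k) + (1 - 1 / n) ^ (i - 1)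
      - of_bool (i \<le> k) * ((1 - 1 / n) ^ (n - k) * (1 - 1 / n) ^ (i - 1))"
  using prob_card_at_pos_steps[OF i, of n k] assms
  by (auto simp: pos_shuffle_eq_pos_steps card_at_def)

text \<open>
  The two events may differ outside the permutations, where \<open>inv\<close> is an arbitrary value, but the
  shuffle is supported on permutations.
\<close>
lemma prob_inv_eq_prob_pos_shuffle:
  "measure_pmf.prob (pos_shuffle n id) {\<sigma>. inv \<sigma> i = k} =
   measure_pmf.prob (pos_shuffle n id) {\<sigma>. \<sigma> k = i}"
proof (rule measure_pmf.finite_measure_eq_AE)
  have "inv \<sigma> i = k \<longleftrightarrow> \<sigma> k = i" if "\<sigma> \<in> set_pmf (pos_shuffle n id)" for \<sigma>
    using that set_pmf_pos_shuffle[OF permutes_id] permutes_inv_eq[of \<sigma>] by blast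
  then show "AE \<sigma> in measure_pmf (pos_shuffle n id).
      \<sigma> \<in> {\<sigma>. inv \<sigma> i = k} \<longleftrightarrow> \<sigma> \<in> {\<sigma>. \<sigma> k = i}"
    by (auto simp: AE_measure_pmf_iff)
qed auto

lemma tendsto_one_minus_inverse_power:
  fixes m :: "nat \<Rightarrow> nat"
  assumes "(\<lambda>n. m n / n) \<longlonglongrightarrow> t"
  shows "(\<lambda>n. (1 - 1 / real n) ^ m n) \<longlonglongrightarrow> exp (- t)"
proof -
  have "(\<lambda>n. real n * ln (1 - 1 / real n)) \<longlonglongrightarrow> -1"
    by real_asymp
  then have "(\<lambda>n. exp ((m n / n) * (real n * ln (1 - 1 / real n)))) \<longlonglongrightarrow> exp (t * - 1)"
    by (intro tendsto_intros assms)
  moreover have "eventually (\<lambda>n. exp ((m n / n) * (real n * ln (1 - 1 / real n)))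
      = (1 - 1 / real n) ^ m n) sequentially"
    using eventually_gt_at_top[of 1]
  proof eventually_elim
    case (elim n)
    then show ?case by (simp add: exp_of_nat_mult)
  qed
  ultimately show ?thesis by (simp add: filterlim_cong)
qed

theorem theorem2:
  fixes bs xs :: "nat \<Rightarrow> real" and b x :: real
  assumes "\<And>n. n \<ge> 1 \<Longrightarrow> bs n * real n \<in> real ` {1..n}"
    and "\<And>n. n \<ge> 1 \<Longrightarrow> xs n * real n \<in> real ` {1..n}"
    and "bs \<longlonglongrightarrow> b" and "b \<in> {0..1}"
    and "xs \<longlonglongrightarrow> x" and "x \<in> {0..1}"
  shows
   "((x < b \<longrightarrow>
        (\<lambda>n. real n * measure_pmf.prob (pos_shuffle n id)
               {\<sigma>. inv \<sigma> (nat \<lfloor>bs n * real n\<rfloor>) = nat \<lfloor>xs n * real n\<rfloor>})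
          \<longlonglongrightarrow> exp (-1 + x) + exp (-b)) \<and>
     (x > b \<longrightarrow>
        (\<lambda>n. real n * measure_pmf.prob (pos_shuffle n id)
               {\<sigma>. inv \<sigma> (nat \<lfloor>bs n * real n\<rfloor>) = nat \<lfloor>xs n * real n\<rfloor>})
          \<longlonglongrightarrow> exp (-1 + x) + exp (-b) - exp (-1 - b + x))) \<and>
    ((b < x \<longrightarrow>
        (\<lambda>n. real n * measure_pmf.prob (pos_shuffle n id)
               {\<sigma>. \<sigma> (nat \<lfloor>xs n * real n\<rfloor>) = nat \<lfloor>bs n * real n\<rfloor>})
          \<longlonglongrightarrow> exp (-1 + x) + exp (-b) - exp (-1 - b + x)) \<and>
     (b > x \<longrightarrow>
        (\<lambda>n. real n * measure_pmf.prob (pos_shuffle n id)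
               {\<sigma>. \<sigma> (nat \<lfloor>xs n * real n\<rfloor>) = nat \<lfloor>bs n * real n\<rfloor>})
          \<longlonglongrightarrow> exp (-1 + x) + exp (-b)))"
proof -
  define i where "i n = nat \<lfloor>bs n * real n\<rfloor>" for n
  define k where "k n = nat \<lfloor>xs n * real n\<rfloor>" for n
  define P where "P n = n * measure_pmf.prob (pos_shuffle n id) {\<sigma>. \<sigma> (k n) = i n}" for n
  have i: "i n \<in> {1..n}" "real (i n) = bs n * n" if "n \<ge> 1" for n
    using assms(1)[OF that] by (auto simp: i_def)
  have k: "k n \<in> {1..n}" "real (k n) = xs n * n" if "n \<ge> 1" for n
    using assms(2)[OF that] by (auto simp: k_def)
  let ?u = "\<lambda>n. 1 - 1 / real n"
  have P: "P n = ?u n ^ (n - k n) + ?u n ^ (i n - 1)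
      - of_bool (i n \<le> k n) * (?u n ^ (n - k n) * ?u n ^ (i n - 1))" if "n \<ge> 1" for n
    unfolding P_def by (intro prob_card_at_pos_shuffle i k that)

  have "(\<lambda>n. real (n - k n) / n) \<longlonglongrightarrow> 1 - x"
  proof (rule Lim_transform_eventually)
    show "(\<lambda>n. 1 - xs n) \<longlonglongrightarrow> 1 - x" by (intro tendsto_intros assms)
    show "\<forall>\<^sub>F n in sequentially. 1 - xs n = real (n - k n) / n"
      using eventually_ge_at_top[of 1]
    proof eventually_elim
      case (elim n)
      then show ?case using k[of n] by (simp add: of_nat_diff field_simps)
    qed
  qed
  from tendsto_one_minus_inverse_power[OF this]
  have lim_k: "(\<lambda>n. ?u n ^ (n - k n)) \<longlonglongrightarrow> exp (-1 + x)" by simp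

  have "(\<lambda>n. real (i n - 1) / n) \<longlonglongrightarrow> b"
  proof (rule Lim_transform_eventually)
    show "(\<lambda>n. bs n - 1 / real n) \<longlonglongrightarrow> b"
      using tendsto_diff[OF assms(3) lim_1_over_n] by simp
    show "\<forall>\<^sub>F n in sequentially. bs n - 1 / real n = real (i n - 1) / n"
      using eventually_ge_at_top[of 1]
    proof eventually_elim
      case (elim n)
      then show ?case using i[of n] by (simp add: of_nat_diff field_simps)
    qed
  qed
  from tendsto_one_minus_inverse_power[OF this]
  have lim_i: "(\<lambda>n. ?u n ^ (i n - 1)) \<longlonglongrightarrow> exp (-b)" .

  have lt: "P \<longlonglongrightarrow> exp (-1 + x) + exp (-b)" if "x < b"
  proof (rule Lim_transform_eventually)
    show "(\<lambda>n. ?u n ^ (n - k n) + ?u n ^ (i n - 1)) \<longlonglongrightarrow> exp (-1 + x) + exp (-b)"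
      by (intro tendsto_add lim_k lim_i)
    have "\<forall>\<^sub>F n in sequentially. 0 < bs n - xs n"
      using that by (intro order_tendstoD[OF tendsto_diff[OF assms(3,5)]]) simp
    with eventually_ge_at_top[of 1]
    show "\<forall>\<^sub>F n in sequentially. ?u n ^ (n - k n) + ?u n ^ (i n - 1) = P n"
    proof eventually_elim
      case (elim n)
      then have "real (k n) < real (i n)" using i(2)[of n] k(2)[of n] by simp
      then show ?case using P[of n] elim by simp
    qed
  qed
  have gt: "P \<longlonglongrightarrow> exp (-1 + x) + exp (-b) - exp (-1 - b + x)" if "b < x"
  proof (rule Lim_transform_eventually)
    have "(\<lambda>n. ?u n ^ (n - k n) + ?u n ^ (i n - 1) - ?u n ^ (n - k n) * ?u n ^ (i n - 1))
        \<longlonglongrightarrow> exp (-1 + x) + exp (-b) - exp (-1 + x) * exp (-b)"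
      by (intro tendsto_intros lim_k lim_i)
    moreover have "exp (-1 + x) * exp (-b) = exp (-1 - b + x)"
      by (simp flip: exp_add add: algebra_simps)
    ultimately show "(\<lambda>n. ?u n ^ (n - k n) + ?u n ^ (i n - 1) - ?u n ^ (n - k n) * ?u n ^ (i n - 1))
        \<longlonglongrightarrow> exp (-1 + x) + exp (-b) - exp (-1 - b + x)" by simp
    have "\<forall>\<^sub>F n in sequentially. 0 < xs n - bs n"
      using that by (intro order_tendstoD[OF tendsto_diff[OF assms(5,3)]]) simp
    with eventually_ge_at_top[of 1]
    show "\<forall>\<^sub>F n in sequentially.
        ?u n ^ (n - k n) + ?u n ^ (i n - 1) - ?u n ^ (n - k n) * ?u n ^ (i n - 1) = P n"
    proof eventually_elim
      case (elim n)
      then have "real (i n) < real (k n)" using i(2)[of n] k(2)[of n] by simp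
      then show ?case using P[of n] elim by simp
    qed
  qed
  show ?thesis
    using lt gt unfolding P_def i_def k_def prob_inv_eq_prob_pos_shuffle by blast
qed

end
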